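(* Let $G_1\subseteq G_2\subseteq\cdots$ be a strict direct sequence of locally compact Hausdorff topological groups and let $G=\bigcup_{n\in\mathbb N}G_n$ be its direct limit topological group. Then $G$ is complete. In particular, the direct limit Lie group $\varinjlim G_n=\bigcup_{n\in\mathbb N}G_n$ is complete for each strict direct sequence $G_1\subseteq G_2\subseteq\cdots$ of finite-dimensional Lie groups.
   Context: A net $(x_\alpha)_{\alpha\in A}$ in a topological group $G$ is a left Cauchy net if for each identity neighbourhood $U\subseteq G$ there is $\gamma\in A$ with $x_\beta^{-1}x_\alpha\in U$ for all $\alpha,\beta\ge\gamma$. $G$ is complete if every left Cauchy net in $G$ converges. A strict direct sequence of topological groups is an ascending sequence $G_1\subseteq G_2\subseteq\cdots$ of topological groups such that each inclusion map $G_n\to G_{n+1}$ is a group homomorphism and a topological embedding. $G=\bigcup_nG_n$ carries the unique group structure making all inclusion maps $G_n\to G$ homomorphisms, and the direct limit topological group is $G$ with the finest topology making it a topological group and all inclusion maps $G_n\to G$ continuous. For finite-dimensional Lie groups $G_n$, the topological group underlying the direct limit Lie group $\varinjlim G_n$ is this direct limit topological group (whose topology then coincides with the final topology with respect to the inclusion maps $G_n\to G$). *)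

theory Defs
  imports "HOL-Analysis.Analysis" "HOL-Algebra.Group"
begin

section \<open>Topological groups and completeness\<close>

definition topological_group :: "('a, 'b) monoid_scheme \<Rightarrow> 'a topology \<Rightarrow> bool" where
  "topological_group G T \<longleftrightarrow>
     group G \<and> topspace T = carrier G \<and>
     continuous_map (prod_topology T T) T (\<lambda>(x, y). x \<otimes>\<^bsub>G\<^esub> y) \<and>
     continuous_map T T (m_inv G)"

text \<open>As usual for nets, a directed set is only required to be preordered.\<close>

definition directed_set :: "'i set \<Rightarrow> ('i \<Rightarrow> 'i \<Rightarrow> bool) \<Rightarrow> bool" where
  "directed_set A leq \<longleftrightarrow>
     A \<noteq> {} \<and>
     (\<forall>\<alpha>\<in>A. leq \<alpha> \<alpha>) \<and>
     (\<forall>\<alpha>\<in>A. \<forall>\<beta>\<in>A. \<forall>\<gamma>\<in>A. leq \<alpha> \<beta> \<and> leq \<beta> \<gamma> \<longrightarrow> leq \<alpha> \<gamma>) \<and>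
     (\<forall>\<alpha>\<in>A. \<forall>\<beta>\<in>A. \<exists>\<gamma>\<in>A. leq \<alpha> \<gamma> \<and> leq \<beta> \<gamma>)"

definition net_converges ::
    "'a topology \<Rightarrow> 'i set \<Rightarrow> ('i \<Rightarrow> 'i \<Rightarrow> bool) \<Rightarrow> ('i \<Rightarrow> 'a) \<Rightarrow> 'a \<Rightarrow> bool" where
  "net_converges T A leq x l \<longleftrightarrow>
     limitin T x l (INF \<gamma>\<in>A. principal {\<alpha>\<in>A. leq \<gamma> \<alpha>})"

lemma net_converges_iff:
  assumes "directed_set A leq"
  shows "net_converges T A leq x l \<longleftrightarrow>
    l \<in> topspace T \<and>
    (\<forall>U. openin T U \<and> l \<in> U \<longrightarrow> (\<exists>\<gamma>\<in>A. \<forall>\<alpha>\<in>A. leq \<gamma> \<alpha> \<longrightarrow> x \<alpha> \<in> U))"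
proof -
  have "eventually P (INF \<gamma>\<in>A. principal {\<alpha>\<in>A. leq \<gamma> \<alpha>}) \<longleftrightarrow>
      (\<exists>\<gamma>\<in>A. eventually P (principal {\<alpha>\<in>A. leq \<gamma> \<alpha>}))" for P
  proof (rule eventually_INF_base)
    show "A \<noteq> {}"
      using assms by (simp add: directed_set_def)
    fix a b
    assume ab: "a \<in> A" "b \<in> A"
    then obtain c where c: "c \<in> A" "leq a c" "leq b c"
      using assms unfolding directed_set_def by meson
    have "leq a \<alpha> \<and> leq b \<alpha>" if "\<alpha> \<in> A" "leq c \<alpha>" for \<alpha>
      using assms ab c that unfolding directed_set_def by meson
    with c show "\<exists>\<gamma>\<in>A. principal {\<alpha>\<in>A. leq \<gamma> \<alpha>} \<le>
        inf (principal {\<alpha>\<in>A. leq a \<alpha>}) (principal {\<alpha>\<in>A. leq b \<alpha>})"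
      by (intro bexI[of _ c]) auto
  qed
  then show ?thesis
    by (simp add: net_converges_def limitin_def eventually_principal Ball_def imp_conjL)
qed

definition left_Cauchy_net ::
    "('a, 'b) monoid_scheme \<Rightarrow> 'a topology \<Rightarrow> 'i set \<Rightarrow> ('i \<Rightarrow> 'i \<Rightarrow> bool) \<Rightarrow> ('i \<Rightarrow> 'a) \<Rightarrow> bool"
  where
  "left_Cauchy_net G T A leq x \<longleftrightarrow>
     directed_set A leq \<and> x \<in> A \<rightarrow> carrier G \<and>
     (\<forall>U \<subseteq> carrier G. \<one>\<^bsub>G\<^esub> \<in> T interior_of U \<longrightarrow>
        (\<exists>\<gamma>\<in>A. \<forall>\<alpha>\<in>A. \<forall>\<beta>\<in>A. leq \<gamma> \<alpha> \<and> leq \<gamma> \<beta> \<longrightarrow> m_inv G (x \<beta>) \<otimes>\<^bsub>G\<^esub> x \<alpha> \<in> U))"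

text \<open>
  A definition cannot quantify over types, so the type of the net indices is a parameter.
  A theorem concluding \<open>complete_topological_group TYPE('i) G T\<close> for a type variable \<open>'i\<close>
  covers nets indexed by arbitrary directed sets.
\<close>

definition complete_topological_group ::
    "'i itself \<Rightarrow> ('a, 'b) monoid_scheme \<Rightarrow> 'a topology \<Rightarrow> bool" where
  "complete_topological_group _ G T \<longleftrightarrow>
     topological_group G T \<and>
     (\<forall>(A :: 'i set) leq x. left_Cauchy_net G T A leq x \<longrightarrow>
        (\<exists>l \<in> carrier G. net_converges T A leq x l))"


section \<open>Strict direct sequences and their direct limits\<close>

text \<open>The inclusion maps are restrictions of the identity of the ambient type.\<close>

definition strict_direct_sequence ::
    "(nat \<Rightarrow> ('a, 'b) monoid_scheme) \<Rightarrow> (nat \<Rightarrow> 'a topology) \<Rightarrow> bool" where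
  "strict_direct_sequence Gs Ts \<longleftrightarrow>
     (\<forall>n. topological_group (Gs n) (Ts n)) \<and>
     (\<forall>n. carrier (Gs n) \<subseteq> carrier (Gs (Suc n)) \<and>
          (\<lambda>x. x) \<in> hom (Gs n) (Gs (Suc n)) \<and>
          embedding_map (Ts n) (Ts (Suc n)) (\<lambda>x. x))"

text \<open>The group structure on the union is determined uniquely by the first three conjuncts.\<close>

definition direct_limit_topological_group ::
    "(nat \<Rightarrow> ('a, 'b) monoid_scheme) \<Rightarrow> (nat \<Rightarrow> 'a topology) \<Rightarrow>
     ('a, 'b) monoid_scheme \<Rightarrow> 'a topology \<Rightarrow> bool" where
  "direct_limit_topological_group Gs Ts G T \<longleftrightarrow>
     group G \<and> carrier G = (\<Union>n. carrier (Gs n)) \<and> (\<forall>n. (\<lambda>x. x) \<in> hom (Gs n) G) \<and>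
     topological_group G T \<and> (\<forall>n. continuous_map (Ts n) T (\<lambda>x. x)) \<and>
     (\<forall>T'. topological_group G T' \<and> (\<forall>n. continuous_map (Ts n) T' (\<lambda>x. x)) \<longrightarrow>
        (\<forall>U. openin T' U \<longrightarrow> openin T U))"


section \<open>Finite-dimensional Lie groups\<close>

text \<open>
  The dimension of the groups in a sequence may be unbounded, so charts take values in the
  space \<open>Euclidean_space d\<close>, whose points are the sequences vanishing from index \<open>d\<close> on.

  \<open>Ck k d V f\<close> says that \<open>f\<close> is \<open>k\<close> times continuously differentiable on the open subset \<open>V\<close>
  of \<open>Euclidean_space d\<close>, that is, all partial derivatives of order at most \<open>k\<close>
  exist and are continuous.
\<close>

fun Ck :: "nat \<Rightarrow> nat \<Rightarrow> (nat \<Rightarrow> real) set \<Rightarrow> ((nat \<Rightarrow> real) \<Rightarrow> real) \<Rightarrow> bool" where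
  "Ck 0 d V f \<longleftrightarrow> continuous_map (subtopology (Euclidean_space d) V) euclideanreal f"
| "Ck (Suc k) d V f \<longleftrightarrow>
     continuous_map (subtopology (Euclidean_space d) V) euclideanreal f \<and>
     (\<forall>i<d. \<exists>g. (\<forall>v\<in>V. ((\<lambda>t. f (v(i := t))) has_real_derivative g v) (at (v i))) \<and>
                Ck k d V g)"

definition smooth_between ::
    "nat \<Rightarrow> nat \<Rightarrow> (nat \<Rightarrow> real) set \<Rightarrow> ((nat \<Rightarrow> real) \<Rightarrow> (nat \<Rightarrow> real)) \<Rightarrow> bool" where
  "smooth_between d e V f \<longleftrightarrow>
     openin (Euclidean_space d) V \<and> f \<in> V \<rightarrow> topspace (Euclidean_space e) \<and>
     (\<forall>k. \<forall>j<e. Ck k d V (\<lambda>v. f v j))"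

type_synonym 'a chart = "'a set \<times> ('a \<Rightarrow> nat \<Rightarrow> real)"

definition smooth_atlas :: "'a topology \<Rightarrow> nat \<Rightarrow> 'a chart set \<Rightarrow> bool" where
  "smooth_atlas T d \<A> \<longleftrightarrow>
     (\<Union>(U, \<phi>)\<in>\<A>. U) = topspace T \<and>
     (\<forall>(U, \<phi>)\<in>\<A>. openin T U \<and> openin (Euclidean_space d) (\<phi> ` U) \<and>
        homeomorphic_map (subtopology T U) (subtopology (Euclidean_space d) (\<phi> ` U)) \<phi>) \<and>
     (\<forall>(U, \<phi>)\<in>\<A>. \<forall>(V, \<psi>)\<in>\<A>. smooth_between d d (\<phi> ` (U \<inter> V)) (\<psi> \<circ> inv_into U \<phi>))"

definition smooth_map ::
    "'a topology \<Rightarrow> nat \<Rightarrow> 'a chart set \<Rightarrow> 'b topology \<Rightarrow> nat \<Rightarrow> 'b chart set \<Rightarrow> ('a \<Rightarrow> 'b) \<Rightarrow> bool"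
  where
  "smooth_map S d \<A> T e \<B> f \<longleftrightarrow>
     continuous_map S T f \<and>
     (\<forall>(U, \<phi>)\<in>\<A>. \<forall>(V, \<psi>)\<in>\<B>.
        smooth_between d e (\<phi> ` {x \<in> U. f x \<in> V}) (\<psi> \<circ> f \<circ> inv_into U \<phi>))"

text \<open>
  \<open>product_atlas d\<close> identifies the product of two copies of \<open>Euclidean_space d\<close> with
  \<open>Euclidean_space (2 * d)\<close> by concatenating coordinates.
\<close>

definition product_atlas :: "nat \<Rightarrow> 'a chart set \<Rightarrow> ('a \<times> 'a) chart set" where
  "product_atlas d \<A> =
     {(U \<times> V, \<lambda>(x, y) i. if i < d then \<phi> x i else \<psi> y (i - d)) | U \<phi> V \<psi>.
        (U, \<phi>) \<in> \<A> \<and> (V, \<psi>) \<in> \<A>}"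

text \<open>
  Lie groups are real, smooth and Hausdorff; second countability is not required.
  The topological group underlying the direct limit Lie group of a strict direct sequence of
  such groups is the one given by \<open>direct_limit_topological_group\<close>.
\<close>

definition Lie_group ::
    "('a, 'b) monoid_scheme \<Rightarrow> 'a topology \<Rightarrow> nat \<Rightarrow> 'a chart set \<Rightarrow> bool" where
  "Lie_group G T d \<A> \<longleftrightarrow>
     group G \<and> topspace T = carrier G \<and> Hausdorff_space T \<and> smooth_atlas T d \<A> \<and>
     smooth_map (prod_topology T T) (2 * d) (product_atlas d \<A>) T d \<A> (\<lambda>(x, y). x \<otimes>\<^bsub>G\<^esub> y) \<and>
     smooth_map T d \<A> T d \<A> (m_inv G)"

end

theory Submission
  imports Defs "HOL-Algebra.Coset"
begin

text \<open>
  Choosing compact identity neighbourhoods \<open>K n\<close> of \<open>Gs n\<close>, each in the interior of the next, one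
  obtains an identity neighbourhood \<open>V = (\<Union>n. K n)\<close> for the final topology, and by compactness the
  \<open>K n\<close> can be kept so small that \<open>V V\<close> lies in a given open set. Hence the final topology is a group
  topology, so it is the direct limit topology. A left Cauchy net can be translated into such a
  \<open>V = (\<Union>n. L n)\<close> with \<open>L n\<close> compact and \<open>L n L n \<subseteq> L (Suc n)\<close>. For some \<open>n\<close> it then meets every
  neighbourhood \<open>L n W\<close> of \<open>L n\<close> cofinally, so by compactness it has a cluster point in \<open>L n\<close>, and
  a left Cauchy net converges to each of its cluster points.
\<close>

section \<open>Topological groups\<close>

lemma topological_groupD:
  assumes "topological_group G T"
  shows "group G" "topspace T = carrier G"
    "continuous_map (prod_topology T T) T (\<lambda>(x, y). x \<otimes>\<^bsub>G\<^esub> y)" "continuous_map T T (m_inv G)"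
  using assms by (auto simp: topological_group_def)

lemma continuous_map_group_mult:
  assumes "topological_group G T" "continuous_map X T f" "continuous_map X T g"
  shows "continuous_map X T (\<lambda>x. f x \<otimes>\<^bsub>G\<^esub> g x)"
proof -
  have "continuous_map X (prod_topology T T) (\<lambda>x. (f x, g x))"
    using assms by (simp add: continuous_map_pairedI)
  then show ?thesis
    using continuous_map_compose[OF _ topological_groupD(3)[OF assms(1)]] by (fastforce simp: comp_def)
qed

lemma openin_left_translate:
  assumes "topological_group G T" "openin T U" "a \<in> carrier G"
  shows "openin T {x \<in> carrier G. a \<otimes>\<^bsub>G\<^esub> x \<in> U}"
proof -
  have "continuous_map T T (\<lambda>x. a \<otimes>\<^bsub>G\<^esub> x)"
    using assms topological_groupD(2)[OF assms(1)]
    by (intro continuous_map_group_mult) auto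
  from openin_continuous_map_preimage[OF this assms(2)] show ?thesis
    using topological_groupD(2)[OF assms(1)] by simp
qed

text \<open>\<open>A <#> U\<close> is a union of left translates of \<open>U\<close>, each of them
  the preimage of \<open>U\<close> under translation by an inverse.\<close>

lemma openin_set_mult:
  assumes "topological_group G T" "openin T U" "A \<subseteq> carrier G"
  shows "openin T (A <#>\<^bsub>G\<^esub> U)"
proof -
  interpret group G using assms(1) by (rule topological_groupD)
  have U: "U \<subseteq> carrier G"
    using openin_subset[OF assms(2)] topological_groupD(2)[OF assms(1)] by simp
  have "A <#>\<^bsub>G\<^esub> U = (\<Union>a\<in>A. {x \<in> carrier G. inv\<^bsub>G\<^esub> a \<otimes>\<^bsub>G\<^esub> x \<in> U})" (is "?L = ?R")
  proof
    show "?L \<subseteq> ?R"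
      using U assms(3) by (force simp: set_mult_def m_assoc[symmetric])
    show "?R \<subseteq> ?L"
    proof clarify
      fix x a assume "a \<in> A" "x \<in> carrier G" and *: "inv\<^bsub>G\<^esub> a \<otimes>\<^bsub>G\<^esub> x \<in> U"
      then have "x = a \<otimes>\<^bsub>G\<^esub> (inv\<^bsub>G\<^esub> a \<otimes>\<^bsub>G\<^esub> x)"
        using assms(3) by (auto simp: m_assoc[symmetric])
      with * \<open>a \<in> A\<close> show "x \<in> A <#>\<^bsub>G\<^esub> U"
        unfolding set_mult_def by blast
    qed
  qed
  moreover have "openin T ?R"
    using assms openin_left_translate[OF assms(1,2)] inv_closed by blast
  ultimately show ?thesis by simp
qed

lemma compactin_set_mult:
  assumes "topological_group G T" "compactin T K" "compactin T L"
  shows "compactin T (K <#>\<^bsub>G\<^esub> L)"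
proof -
  have "compactin T ((\<lambda>(x, y). x \<otimes>\<^bsub>G\<^esub> y) ` (K \<times> L))"
    using assms by (intro image_compactin[OF _ topological_groupD(3)]) (auto simp: compactin_Times)
  moreover have "(\<lambda>(x, y). x \<otimes>\<^bsub>G\<^esub> y) ` (K \<times> L) = K <#>\<^bsub>G\<^esub> L"
    by (auto simp: set_mult_def)
  ultimately show ?thesis by simp
qed

text \<open>The compact square \<open>K \<times> K\<close> lies in the open preimage of
  \<open>U\<close> under multiplication. Wallace's theorem puts an open box
  \<open>V \<times> W\<close> between them, and \<open>V \<inter> W\<close> serves for both
  factors.\<close>

lemma compact_square_neighbourhood:
  assumes "topological_group G T" "compactin T K" "openin T U" "K <#>\<^bsub>G\<^esub> K \<subseteq> U"
  obtains W where "openin T W" "K \<subseteq> W" "W <#>\<^bsub>G\<^esub> W \<subseteq> U"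
proof -
  let ?P = "{p \<in> topspace (prod_topology T T). (\<lambda>(x, y). x \<otimes>\<^bsub>G\<^esub> y) p \<in> U}"
  have "openin (prod_topology T T) ?P"
    using openin_continuous_map_preimage[OF topological_groupD(3)[OF assms(1)] assms(3)] .
  moreover have "K \<times> K \<subseteq> ?P"
    using assms(4) compactin_subset_topspace[OF assms(2)] by (fastforce simp: set_mult_def)
  ultimately obtain V W where VW: "openin T V" "openin T W" "K \<subseteq> V" "K \<subseteq> W" "V \<times> W \<subseteq> ?P"
    by (rule Wallace_theorem_prod_topology[OF assms(2,2)])
  show thesis
  proof
    show "openin T (V \<inter> W)" using VW by blast
    show "K \<subseteq> V \<inter> W" using VW by blast
    show "V \<inter> W <#>\<^bsub>G\<^esub> V \<inter> W \<subseteq> U" using VW by (fastforce simp: set_mult_def)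
  qed
qed

lemma one_square_neighbourhood:
  assumes "topological_group G T" "openin T U" "\<one>\<^bsub>G\<^esub> \<in> U"
  obtains W where "openin T W" "\<one>\<^bsub>G\<^esub> \<in> W" "W <#>\<^bsub>G\<^esub> W \<subseteq> U"
proof -
  interpret group G using assms(1) by (rule topological_groupD)
  show thesis
    using compact_square_neighbourhood[OF assms(1) _ assms(2), of "{\<one>\<^bsub>G\<^esub>}"] assms(3) that
      topological_groupD(2)[OF assms(1)]
    by (auto simp: set_mult_def)
qed

text \<open>Open subspaces inherit both properties, so a compact neighbourhood of \<open>K\<close>
  exists within the subspace \<open>U\<close>; its openness and compactness then pass to
  \<open>X\<close>. Local compactness and the Hausdorff property of the \<open>Gs n\<close> are
  exploited only through this lemma.\<close>

lemma locally_compact_Hausdorff_between: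
  assumes "locally_compact_space X" "Hausdorff_space X" "compactin X K" "openin X U" "K \<subseteq> U"
  obtains V C where "openin X V" "compactin X C" "K \<subseteq> V" "V \<subseteq> C" "C \<subseteq> U"
proof -
  have "locally_compact_space (subtopology X U)" "Hausdorff_space (subtopology X U)"
    using assms by (auto simp: locally_compact_space_open_subset Hausdorff_space_subtopology)
  moreover have "compactin (subtopology X U) K"
    using assms by (simp add: compactin_subtopology)
  ultimately obtain V C where "openin (subtopology X U) V" "compactin (subtopology X U) C" "K \<subseteq> V" "V \<subseteq> C"
    using locally_compact_space_compact_closed_compact by metis
  with assms that show thesis
    by (metis compactin_subtopology openin_trans_full)
qed

section \<open>Left Cauchy nets\<close>

lemma left_Cauchy_netD:
  assumes "left_Cauchy_net G T A leq x"
  shows "A \<noteq> {}"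
    "\<And>a b. a \<in> A \<Longrightarrow> b \<in> A \<Longrightarrow> \<exists>c\<in>A. \<forall>d\<in>A. leq c d \<longrightarrow> leq a d \<and> leq b d"
    "\<And>a. a \<in> A \<Longrightarrow> leq a a"
    "\<And>a. a \<in> A \<Longrightarrow> x a \<in> carrier G"
proof -
  have D: "directed_set A leq" and x: "x \<in> A \<rightarrow> carrier G"
    using assms by (auto simp: left_Cauchy_net_def)
  show "A \<noteq> {}" "\<And>a. a \<in> A \<Longrightarrow> leq a a" "\<And>a. a \<in> A \<Longrightarrow> x a \<in> carrier G"
    using D x by (auto simp: directed_set_def)
  \<comment> \<open>Transitivity is built into this form of directedness: everything beyond
    \<open>c\<close> is beyond both \<open>a\<close> and \<open>b\<close>.\<close>
  show "\<exists>c\<in>A. \<forall>d\<in>A. leq c d \<longrightarrow> leq a d \<and> leq b d" if "a \<in> A" "b \<in> A" for a b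
  proof -
    obtain c where c: "c \<in> A" "leq a c" "leq b c"
      using D \<open>a \<in> A\<close> \<open>b \<in> A\<close> unfolding directed_set_def by blast
    have "leq u w" if "u \<in> A" "v \<in> A" "w \<in> A" "leq u v" "leq v w" for u v w
      using D that unfolding directed_set_def by blast
    with c that show ?thesis by blast
  qed
qed

lemma left_Cauchy_net_openD:
  assumes "left_Cauchy_net G T A leq x" "topological_group G T" "openin T U" "\<one>\<^bsub>G\<^esub> \<in> U"
  obtains c where "c \<in> A"
    "\<And>a b. a \<in> A \<Longrightarrow> b \<in> A \<Longrightarrow> leq c a \<Longrightarrow> leq c b \<Longrightarrow> inv\<^bsub>G\<^esub> (x b) \<otimes>\<^bsub>G\<^esub> x a \<in> U"
proof -
  have "U \<subseteq> carrier G" "\<one>\<^bsub>G\<^esub> \<in> T interior_of U"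
    using assms openin_subset[of T U] by (auto simp: topological_groupD interior_of_openin)
  then show thesis
    using assms(1) that unfolding left_Cauchy_net_def by metis
qed

text \<open>Clustering gives a late \<open>b\<close> with \<open>inv l x b\<close> in
  \<open>W\<close>, and the Cauchy condition gives \<open>inv (x b) x a\<close> in \<open>W\<close>
  for all late \<open>a\<close>. The product is \<open>inv l x a\<close>, so \<open>x a\<close> lies
  in \<open>l W W\<close>, which is contained in \<open>U\<close>.\<close>

lemma left_Cauchy_net_cluster_point_converges:
  assumes C: "left_Cauchy_net G T A leq x" and G: "topological_group G T" and l: "l \<in> carrier G"
    and cluster: "\<And>U c. \<lbrakk>openin T U; l \<in> U; c \<in> A\<rbrakk> \<Longrightarrow> \<exists>a\<in>A. leq c a \<and> x a \<in> U"
  shows "net_converges T A leq x l"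
proof -
  interpret group G using G by (rule topological_groupD)
  have top: "topspace T = carrier G" using G by (rule topological_groupD)
  have "\<exists>c\<in>A. \<forall>a\<in>A. leq c a \<longrightarrow> x a \<in> U" if U: "openin T U" "l \<in> U" for U
  proof -
    have "openin T {x \<in> carrier G. l \<otimes>\<^bsub>G\<^esub> x \<in> U}"
      using openin_left_translate[OF G U(1) l] .
    then obtain W where W: "openin T W" "\<one>\<^bsub>G\<^esub> \<in> W" "W <#>\<^bsub>G\<^esub> W \<subseteq> {x \<in> carrier G. l \<otimes>\<^bsub>G\<^esub> x \<in> U}"
      using one_square_neighbourhood[OF G, of "{x \<in> carrier G. l \<otimes>\<^bsub>G\<^esub> x \<in> U}"] U l by auto
    obtain c where c: "c \<in> A"
      "\<And>a b. a \<in> A \<Longrightarrow> b \<in> A \<Longrightarrow> leq c a \<Longrightarrow> leq c b \<Longrightarrow> inv\<^bsub>G\<^esub> (x b) \<otimes>\<^bsub>G\<^esub> x a \<in> W"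
      using left_Cauchy_net_openD[OF C G W(1,2)] by blast
    have "openin T {y \<in> carrier G. inv\<^bsub>G\<^esub> l \<otimes>\<^bsub>G\<^esub> y \<in> W}"
      using openin_left_translate[OF G W(1)] l by simp
    moreover have "l \<in> {y \<in> carrier G. inv\<^bsub>G\<^esub> l \<otimes>\<^bsub>G\<^esub> y \<in> W}"
      using l W by simp
    ultimately obtain b where b: "b \<in> A" "leq c b" "inv\<^bsub>G\<^esub> l \<otimes>\<^bsub>G\<^esub> x b \<in> W"
      using cluster c(1) by blast
    show ?thesis
    proof (intro bexI[of _ c] ballI impI)
      fix a assume a: "a \<in> A" "leq c a"
      have xab: "x a \<in> carrier G" "x b \<in> carrier G"
        using left_Cauchy_netD(4)[OF C] a b by auto
      have "(inv\<^bsub>G\<^esub> l \<otimes>\<^bsub>G\<^esub> x b) \<otimes>\<^bsub>G\<^esub> (inv\<^bsub>G\<^esub> (x b) \<otimes>\<^bsub>G\<^esub> x a) \<in> W <#>\<^bsub>G\<^esub> W"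
        unfolding set_mult_def using b c(2)[OF a(1) b(1) a(2) b(2)] by blast
      then have "l \<otimes>\<^bsub>G\<^esub> ((inv\<^bsub>G\<^esub> l \<otimes>\<^bsub>G\<^esub> x b) \<otimes>\<^bsub>G\<^esub> (inv\<^bsub>G\<^esub> (x b) \<otimes>\<^bsub>G\<^esub> x a)) \<in> U"
        using W(3) by blast
      moreover have "l \<otimes>\<^bsub>G\<^esub> ((inv\<^bsub>G\<^esub> l \<otimes>\<^bsub>G\<^esub> x b) \<otimes>\<^bsub>G\<^esub> (inv\<^bsub>G\<^esub> (x b) \<otimes>\<^bsub>G\<^esub> x a)) = x a"
        using l xab by (metis inv_closed inv_solve_left m_assoc m_closed)
      ultimately show "x a \<in> U" by simp
    qed (use c in auto)
  qed
  moreover have "directed_set A leq" using C by (simp add: left_Cauchy_net_def)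
  ultimately show ?thesis
    using l top by (simp add: net_converges_iff)
qed

text \<open>The net itself may miss \<open>K\<close>. If it had no limit, no \<open>l\<close> in
  \<open>K\<close> would be a cluster point, so each would have a neighbourhood \<open>l P P\<close>
  that is eventually avoided. Finitely many \<open>l P\<close> cover \<open>K\<close>; with
  \<open>W\<close> the intersection of their \<open>P\<close>, the set \<open>K W\<close> is covered
  by the finitely many \<open>l P P\<close>, contradicting \<open>near\<close>.\<close>

lemma left_Cauchy_net_near_compact_converges:
  assumes C: "left_Cauchy_net G T A leq x" and G: "topological_group G T" and K: "compactin T K"
    and near: "\<And>W c. \<lbrakk>openin T W; \<one>\<^bsub>G\<^esub> \<in> W; c \<in> A\<rbrakk> \<Longrightarrow> \<exists>a\<in>A. leq c a \<and> x a \<in> K <#>\<^bsub>G\<^esub> W"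
  shows "\<exists>l\<in>carrier G. net_converges T A leq x l"
proof (rule ccontr)
  assume contra: "\<not> ?thesis"
  interpret group G using G by (rule topological_groupD)
  have top: "topspace T = carrier G" using G by (rule topological_groupD)
  have KG: "K \<subseteq> carrier G" using compactin_subset_topspace[OF K] top by simp
  have "\<exists>P c. openin T P \<and> \<one>\<^bsub>G\<^esub> \<in> P \<and> c \<in> A \<and>
      (\<forall>a\<in>A. leq c a \<longrightarrow> x a \<notin> {l} <#>\<^bsub>G\<^esub> (P <#>\<^bsub>G\<^esub> P))" if "l \<in> K" for l
  proof -
    have l: "l \<in> carrier G" using that KG by auto
    then obtain U c where U: "openin T U" "l \<in> U" "c \<in> A" "\<And>a. a \<in> A \<Longrightarrow> leq c a \<Longrightarrow> x a \<notin> U"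
      using left_Cauchy_net_cluster_point_converges[OF C G l] contra by blast
    have "openin T {x \<in> carrier G. l \<otimes>\<^bsub>G\<^esub> x \<in> U}"
      using openin_left_translate[OF G U(1) l] .
    then obtain P where P: "openin T P" "\<one>\<^bsub>G\<^esub> \<in> P" "P <#>\<^bsub>G\<^esub> P \<subseteq> {x \<in> carrier G. l \<otimes>\<^bsub>G\<^esub> x \<in> U}"
      using one_square_neighbourhood[OF G, of "{x \<in> carrier G. l \<otimes>\<^bsub>G\<^esub> x \<in> U}"] U l by auto
    then have "{l} <#>\<^bsub>G\<^esub> (P <#>\<^bsub>G\<^esub> P) \<subseteq> U"
      unfolding set_mult_def by blast
    with U P show ?thesis by blast
  qed
  then obtain P c where P: "\<And>l. l \<in> K \<Longrightarrow> openin T (P l)" "\<And>l. l \<in> K \<Longrightarrow> \<one>\<^bsub>G\<^esub> \<in> P l"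
    and c: "\<And>l. l \<in> K \<Longrightarrow> c l \<in> A"
      "\<And>l a. l \<in> K \<Longrightarrow> a \<in> A \<Longrightarrow> leq (c l) a \<Longrightarrow> x a \<notin> {l} <#>\<^bsub>G\<^esub> (P l <#>\<^bsub>G\<^esub> P l)"
    by metis
  have "\<exists>\<F>. finite \<F> \<and> \<F> \<subseteq> (\<lambda>l. {l} <#>\<^bsub>G\<^esub> P l) ` K \<and> K \<subseteq> \<Union>\<F>"
  proof (rule compactinD[OF K])
    fix U assume "U \<in> (\<lambda>l. {l} <#>\<^bsub>G\<^esub> P l) ` K"
    then show "openin T U" using P KG openin_set_mult[OF G] by blast
  next
    show "K \<subseteq> (\<Union>l\<in>K. {l} <#>\<^bsub>G\<^esub> P l)"
      using P(2) KG by (force simp: set_mult_def)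
  qed
  then obtain \<F> where "finite \<F>" "\<F> \<subseteq> (\<lambda>l. {l} <#>\<^bsub>G\<^esub> P l) ` K" "K \<subseteq> \<Union>\<F>"
    by blast
  moreover from finite_subset_image[OF this(1,2)]
  obtain F where "F \<subseteq> K" "finite F" "\<F> = (\<lambda>l. {l} <#>\<^bsub>G\<^esub> P l) ` F"
    by blast
  ultimately have F: "finite F" "F \<subseteq> K" "K \<subseteq> (\<Union>l\<in>F. {l} <#>\<^bsub>G\<^esub> P l)"
    by auto
  \<comment> \<open>The factor \<open>topspace T\<close> keeps this open for empty \<open>F\<close>,
    where the intersection over \<open>F\<close> is the whole type.\<close>
  let ?W = "topspace T \<inter> (\<Inter>l\<in>F. P l)"
  have W: "openin T ?W"
    using F P by (cases "F = {}") (auto intro!: openin_Int_Inter)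
  have one_W: "\<one>\<^bsub>G\<^esub> \<in> ?W" using P F top by auto
  have "\<exists>d\<in>A. \<forall>a\<in>A. leq d a \<longrightarrow> (\<forall>l\<in>F. leq (c l) a)"
    using F(1,2)
  proof (induction F)
    case empty
    then show ?case using left_Cauchy_netD(1)[OF C] by auto
  next
    case (insert l F)
    then obtain d where "d \<in> A" "\<forall>a\<in>A. leq d a \<longrightarrow> (\<forall>l\<in>F. leq (c l) a)" by auto
    moreover obtain e where "e \<in> A" "\<forall>a\<in>A. leq e a \<longrightarrow> leq d a \<and> leq (c l) a"
      using left_Cauchy_netD(2)[OF C \<open>d \<in> A\<close> c(1)] insert.prems by blast
    ultimately show ?case by (intro bexI[of _ e]) auto
  qed
  then obtain d where d: "d \<in> A" "\<And>a l. a \<in> A \<Longrightarrow> leq d a \<Longrightarrow> l \<in> F \<Longrightarrow> leq (c l) a"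
    by blast
  obtain a where a: "a \<in> A" "leq d a" "x a \<in> K <#>\<^bsub>G\<^esub> ?W"
    using near[OF W one_W d(1)] by blast
  then obtain k w where kw: "k \<in> K" "w \<in> ?W" "x a = k \<otimes>\<^bsub>G\<^esub> w"
    unfolding set_mult_def by blast
  then obtain l p where lp: "l \<in> F" "p \<in> P l" "k = l \<otimes>\<^bsub>G\<^esub> p"
    using F(3) unfolding set_mult_def by blast
  have "p \<in> carrier G" "l \<in> carrier G" "w \<in> carrier G"
    using lp kw F(2) KG top openin_subset[OF P(1)[of l]] by auto
  then have "x a = l \<otimes>\<^bsub>G\<^esub> (p \<otimes>\<^bsub>G\<^esub> w)"
    using kw lp m_assoc by simp
  moreover have "w \<in> P l" using kw lp by blast
  ultimately have "x a \<in> {l} <#>\<^bsub>G\<^esub> (P l <#>\<^bsub>G\<^esub> P l)"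
    using lp unfolding set_mult_def by blast
  with c(2)[of l a] d(2)[OF a(1,2) lp(1)] a lp F(2) show False by blast
qed

section \<open>The final topology on the union\<close>

text \<open>No topology on \<open>G\<close> is fixed here: the final topology is constructed and
  shown to be a group topology before it is compared with a given direct limit topology.\<close>

locale locally_compact_direct_sequence = group G
  for G :: "('a, 'b) monoid_scheme" (structure) +
  fixes Gs :: "nat \<Rightarrow> ('a, 'b) monoid_scheme" and Ts :: "nat \<Rightarrow> 'a topology"
  assumes strict: "strict_direct_sequence Gs Ts"
    and carrier_limit: "carrier G = (\<Union>n. carrier (Gs n))"
    and inclusion_hom: "(\<lambda>x. x) \<in> hom (Gs n) G"
    and locally_compact: "locally_compact_space (Ts n)"
    and Hausdorff: "Hausdorff_space (Ts n)"
begin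

section \<open>Compatibility of the groups and topologies in the sequence\<close>

lemma topological_group_step: "topological_group (Gs n) (Ts n)"
  using strict by (simp add: strict_direct_sequence_def)

lemma group_step: "group (Gs n)"
  using topological_group_step by (rule topological_groupD)

lemma topspace_step: "topspace (Ts n) = carrier (Gs n)"
  using topological_group_step by (rule topological_groupD)

lemma carrier_mono:
  assumes "m \<le> n"
  shows "carrier (Gs m) \<subseteq> carrier (Gs n)"
proof -
  have "carrier (Gs k) \<subseteq> carrier (Gs (Suc k))" for k
    using strict unfolding strict_direct_sequence_def by blast
  from lift_Suc_mono_le[of "\<lambda>k. carrier (Gs k)", OF this assms] show ?thesis .
qed

lemma carrier_step_subset: "carrier (Gs n) \<subseteq> carrier G"
  using carrier_limit by blast

lemma mult_step: "x \<in> carrier (Gs n) \<Longrightarrow> y \<in> carrier (Gs n) \<Longrightarrow> x \<otimes>\<^bsub>Gs n\<^esub> y = x \<otimes> y"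
  using inclusion_hom[of n] by (auto simp: hom_def)

lemma group_hom_step: "group_hom (Gs n) G (\<lambda>x. x)"
  using inclusion_hom group_step is_group by (simp add: group_hom_def group_hom_axioms_def)

lemma one_step: "\<one>\<^bsub>Gs n\<^esub> = \<one>"
  using group_hom.hom_one[OF group_hom_step] .

lemma inv_step: "x \<in> carrier (Gs n) \<Longrightarrow> inv\<^bsub>Gs n\<^esub> x = inv x"
  using group_hom.hom_inv[OF group_hom_step] .

lemma set_mult_step:
  assumes "A \<subseteq> carrier (Gs n)" "B \<subseteq> carrier (Gs n)"
  shows "A <#>\<^bsub>Gs n\<^esub> B = A <#> B"
proof -
  have "x \<otimes>\<^bsub>Gs n\<^esub> y = x \<otimes> y" if "x \<in> A" "y \<in> B" for x y
    using that assms mult_step by blast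
  then show ?thesis by (simp add: set_mult_def)
qed

lemma one_in_step: "\<one> \<in> carrier (Gs n)"
  using monoid.one_closed[OF group.is_monoid[OF group_step[of n]]] one_step[of n] by simp

text \<open>The identity being a homeomorphism onto its image means equality of topologies, so
  strictness becomes an equation for consecutive steps, which is then iterated.\<close>

lemma subtopology_step:
  assumes "m \<le> n"
  shows "Ts m = subtopology (Ts n) (carrier (Gs m))"
  using assms
proof (induction n rule: dec_induct)
  case base
  show ?case using topspace_step by (metis subtopology_topspace)
next
  case (step n)
  have "embedding_map (Ts n) (Ts (Suc n)) (\<lambda>x. x)"
    using strict by (simp add: strict_direct_sequence_def)
  then have "homeomorphic_map (Ts n) (subtopology (Ts (Suc n)) (carrier (Gs n))) id"
    by (simp add: embedding_map_def topspace_step id_def)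
  then have "Ts n = subtopology (Ts (Suc n)) (carrier (Gs n))"
    by simp
  with step carrier_mono[of m n] show ?case
    by (metis inf.absorb2 subtopology_subtopology)
qed

section \<open>Construction of the final topology and separate continuity\<close>

definition final_topology :: "'a topology" where
  "final_topology = topology (\<lambda>U. U \<subseteq> carrier G \<and> (\<forall>n. openin (Ts n) (U \<inter> carrier (Gs n))))"

lemma openin_final_topology:
  "openin final_topology U \<longleftrightarrow> U \<subseteq> carrier G \<and> (\<forall>n. openin (Ts n) (U \<inter> carrier (Gs n)))"
proof -
  have "istopology (\<lambda>U. U \<subseteq> carrier G \<and> (\<forall>n. openin (Ts n) (U \<inter> carrier (Gs n))))"
    unfolding istopology_def
  proof (intro conjI allI impI)
    fix S T n
    assume "S \<subseteq> carrier G \<and> (\<forall>n. openin (Ts n) (S \<inter> carrier (Gs n)))"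
      "T \<subseteq> carrier G \<and> (\<forall>n. openin (Ts n) (T \<inter> carrier (Gs n)))"
    then have "openin (Ts n) ((S \<inter> carrier (Gs n)) \<inter> (T \<inter> carrier (Gs n)))" by blast
    then show "openin (Ts n) (S \<inter> T \<inter> carrier (Gs n))"
      by (simp add: Int_ac)
  next
    fix \<K> n
    assume "\<forall>K\<in>\<K>. K \<subseteq> carrier G \<and> (\<forall>n. openin (Ts n) (K \<inter> carrier (Gs n)))"
    then have "openin (Ts n) (\<Union>K\<in>\<K>. K \<inter> carrier (Gs n))" by blast
    then show "openin (Ts n) (\<Union>\<K> \<inter> carrier (Gs n))"
      by (simp add: Int_commute Int_Union)
  qed auto
  then show ?thesis
    by (simp add: final_topology_def topology_inverse')
qed

lemma topspace_final_topology: "topspace final_topology = carrier G"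
proof -
  have "openin final_topology (carrier G)"
    using openin_topspace[of "Ts _"] carrier_step_subset
    by (simp add: openin_final_topology Int_absorb1 topspace_step)
  moreover have "topspace final_topology \<subseteq> carrier G"
    using openin_final_topology[of "topspace final_topology"] by simp
  ultimately show ?thesis
    by (simp add: openin_subset subset_antisym)
qed

text \<open>The universal property of the final topology. It handles translations and inversion, but
  not multiplication: the product of two final topologies need not be final with respect to the
  products of the steps.\<close>

lemma continuous_map_from_final_topology:
  "continuous_map final_topology X f \<longleftrightarrow> (\<forall>n. continuous_map (Ts n) X f)"
proof -
  have *: "{x \<in> carrier G. f x \<in> U} \<inter> carrier (Gs n) = {x \<in> carrier (Gs n). f x \<in> U}" for U n
    using carrier_step_subset by blast
  show ?thesis
    unfolding continuous_map_def topspace_final_topology topspace_step openin_final_topology *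
    by (auto simp: carrier_limit)
qed

lemma continuous_map_step_final: "continuous_map (Ts n) final_topology (\<lambda>x. x)"
  using continuous_map_from_final_topology[of final_topology "\<lambda>x. x"] by simp

lemma continuous_map_step_mono: "m \<le> n \<Longrightarrow> continuous_map (Ts m) (Ts n) (\<lambda>x. x)"
  using subtopology_step[of m n] by (simp add: continuous_map_from_subtopology)

text \<open>As \<open>a\<close> need not lie in \<open>Gs n\<close>, the translation of
  \<open>Gs n\<close> by \<open>a\<close> is computed in \<open>Gs (max n k)\<close>, which contains
  both.\<close>

lemma continuous_map_final_translate:
  assumes "a \<in> carrier G"
  shows "continuous_map final_topology final_topology (\<lambda>x. a \<otimes> x)"
    and "continuous_map final_topology final_topology (\<lambda>x. x \<otimes> a)"
proof -
  obtain k where k: "a \<in> carrier (Gs k)" using assms carrier_limit by blast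
  have "continuous_map (Ts n) final_topology (\<lambda>x. a \<otimes> x) \<and>
      continuous_map (Ts n) final_topology (\<lambda>x. x \<otimes> a)" for n
  proof -
    let ?m = "max n k"
    have a: "a \<in> carrier (Gs ?m)" using k carrier_mono[of k ?m] by auto
    then have c: "continuous_map (Ts n) (Ts ?m) (\<lambda>x. a)"
      by (simp add: topspace_step)
    have i: "continuous_map (Ts n) (Ts ?m) (\<lambda>x. x)"
      by (simp add: continuous_map_step_mono)
    have sub: "x \<in> carrier (Gs ?m)" if "x \<in> topspace (Ts n)" for x
      using that carrier_mono[of n ?m] by (auto simp: topspace_step)
    have "continuous_map (Ts n) (Ts ?m) (\<lambda>x. a \<otimes> x)"
      using continuous_map_group_mult[OF topological_group_step c i]
      by (rule continuous_map_eq) (simp add: mult_step a sub)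
    moreover have "continuous_map (Ts n) (Ts ?m) (\<lambda>x. x \<otimes> a)"
      using continuous_map_group_mult[OF topological_group_step i c]
      by (rule continuous_map_eq) (simp add: mult_step a sub)
    ultimately show ?thesis
      using continuous_map_compose[OF _ continuous_map_step_final[of ?m]] by (force simp: comp_def)
  qed
  then show "continuous_map final_topology final_topology (\<lambda>x. a \<otimes> x)"
    "continuous_map final_topology final_topology (\<lambda>x. x \<otimes> a)"
    by (auto simp: continuous_map_from_final_topology)
qed

lemma continuous_map_final_inv: "continuous_map final_topology final_topology (m_inv G)"
proof -
  have "continuous_map (Ts n) final_topology (m_inv G)" for n
  proof -
    have "continuous_map (Ts n) (Ts n) (m_inv G)"
      using topological_groupD(4)[OF topological_group_step]
      by (rule continuous_map_eq) (simp add: inv_step topspace_step)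
    then show ?thesis
      using continuous_map_compose[OF _ continuous_map_step_final[of n]] by (force simp: comp_def)
  qed
  then show ?thesis by (simp add: continuous_map_from_final_topology)
qed

text \<open>The sets \<open>A n\<close> need not be open in the union, nor does \<open>A n\<close> have to be open in \<open>Ts (Suc n)\<close>.\<close>
lemma openin_final_topology_increasing_UN:
  assumes "\<And>n. openin (Ts n) (A n)" "\<And>n. A n \<subseteq> A (Suc n)"
  shows "openin final_topology (\<Union>n. A n)"
proof -
  have mono: "A m \<subseteq> A n" if "m \<le> n" for m n
    using lift_Suc_mono_le[of A, OF assms(2) that] .
  have "openin (Ts n) ((\<Union>n. A n) \<inter> carrier (Gs n))" for n
  proof -
    have *: "openin (Ts n) (A m \<inter> carrier (Gs n))" if "n \<le> m" for m
      using assms(1)[of m] subtopology_step[OF that] by (metis openin_subtopology)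
    have "(\<Union>n. A n) \<inter> carrier (Gs n) = (\<Union>m\<in>{n..}. A m \<inter> carrier (Gs n))"
      using mono[OF max.cobounded1] max.cobounded2 by fastforce
    moreover have "openin (Ts n) (\<Union>m\<in>{n..}. A m \<inter> carrier (Gs n))"
      using * by (intro openin_Union) auto
    ultimately show ?thesis by (simp only:)
  qed
  moreover have "A n \<subseteq> carrier G" for n
    using openin_subset[OF assms(1)] carrier_step_subset topspace_step by blast
  ultimately show ?thesis
    by (auto simp: openin_final_topology)
qed

section \<open>Joint continuity of multiplication in the final topology\<close>

lemma compactin_step_mono: "compactin (Ts m) K \<Longrightarrow> m \<le> n \<Longrightarrow> compactin (Ts n) K"
  using subtopology_step[of m n] by (simp add: compactin_subtopology)

lemma compactin_step_subset: "compactin (Ts n) K \<Longrightarrow> K \<subseteq> carrier (Gs n)"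
  using compactin_subset_topspace topspace_step by blast

lemma openin_step_subset: "openin (Ts n) K \<Longrightarrow> K \<subseteq> carrier (Gs n)"
  using openin_subset topspace_step by blast

text \<open>Each stage consists of an open set \<open>fst p\<close> inside a compact set
  \<open>snd p\<close> whose square lies in \<open>U\<close>, and the compact set lies in the next
  open set. \<open>V\<close> is the union of the open sets; two of its elements lie in the compact
  set of a common stage, so their product is in \<open>U\<close>.\<close>

lemma final_square_neighbourhood:
  assumes U: "openin final_topology U" "\<one> \<in> U"
  shows "\<exists>V. openin final_topology V \<and> \<one> \<in> V \<and> V <#> V \<subseteq> U"
proof -
  let ?P = "\<lambda>n p. openin (Ts n) (fst p) \<and> compactin (Ts n) (snd p) \<and> \<one> \<in> fst p \<and>
    fst p \<subseteq> snd p \<and> snd p <#> snd p \<subseteq> U"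
  \<comment> \<open>Being compact with square in \<open>U\<close> is enough to enlarge
    \<open>C\<close>: the tube argument in \<open>Gs n\<close> gives an open \<open>W\<close> around
    \<open>C\<close> with square in \<open>U\<close>, and a compact neighbourhood of
    \<open>C\<close> fits inside \<open>W\<close>.\<close>
  have extend: "\<exists>p. ?P n p \<and> C \<subseteq> fst p" if C: "compactin (Ts n) C" "\<one> \<in> C" "C <#> C \<subseteq> U" for n C
  proof -
    have CG: "C \<subseteq> carrier (Gs n)" using C compactin_step_subset by blast
    have "openin (Ts n) (U \<inter> carrier (Gs n))" using U by (simp add: openin_final_topology)
    moreover have "C <#>\<^bsub>Gs n\<^esub> C \<subseteq> U \<inter> carrier (Gs n)"
      using C CG set_mult_step compactin_step_subset[OF compactin_set_mult[OF topological_group_step C(1,1)]]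
      by simp
    ultimately obtain W where W: "openin (Ts n) W" "C \<subseteq> W" "W <#>\<^bsub>Gs n\<^esub> W \<subseteq> U \<inter> carrier (Gs n)"
      using compact_square_neighbourhood[OF topological_group_step C(1)] by metis
    then obtain V K where VK: "openin (Ts n) V" "compactin (Ts n) K" "C \<subseteq> V" "V \<subseteq> K" "K \<subseteq> W"
      using locally_compact_Hausdorff_between[OF locally_compact Hausdorff C(1)] by metis
    have "K <#> K \<subseteq> W <#> W" using VK unfolding set_mult_def by blast
    also have "\<dots> \<subseteq> U" using W(3) set_mult_step[OF openin_step_subset openin_step_subset, OF W(1,1)] by simp
    finally show ?thesis using VK C by (intro exI[of _ "(V, K)"]) auto
  qed
  \<comment> \<open>The recursion starts from \<open>{\<one>}\<close>; the compact set of stage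
    \<open>n\<close> stays compact in \<open>Ts (Suc n)\<close> and is enlarged there.\<close>
  have "\<exists>f. \<forall>n. ?P n (f n) \<and> snd (f n) \<subseteq> fst (f (Suc n))"
  proof (rule dependent_nat_choice)
    have "compactin (Ts 0) {\<one>}" using one_in_step topspace_step by simp
    moreover have "{\<one>} <#> {\<one>} \<subseteq> U" using U by (simp add: set_mult_def)
    ultimately show "\<exists>p. ?P 0 p" using extend[of 0 "{\<one>}"] by blast
  next
    fix p n assume "?P n p"
    then show "\<exists>q. ?P (Suc n) q \<and> snd p \<subseteq> fst q"
      using extend[of "Suc n" "snd p"] compactin_step_mono[of n "snd p" "Suc n"] by auto
  qed
  then obtain f where f: "\<forall>n. ?P n (f n) \<and> snd (f n) \<subseteq> fst (f (Suc n))" ..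
  have P: "openin (Ts n) (fst (f n))" "\<one> \<in> fst (f n)" "fst (f n) \<subseteq> snd (f n)"
    "snd (f n) <#> snd (f n) \<subseteq> U" for n
    using f by blast+
  have step: "fst (f n) \<subseteq> fst (f (Suc n))" for n using f by blast
  have mono: "fst (f m) \<subseteq> fst (f n)" if "m \<le> n" for m n
    using lift_Suc_mono_le[of "\<lambda>n. fst (f n)", OF step that] .
  show ?thesis
  proof (intro exI[of _ "\<Union>n. fst (f n)"] conjI)
    show "openin final_topology (\<Union>n. fst (f n))"
      by (rule openin_final_topology_increasing_UN[OF P(1) step])
    show "\<one> \<in> (\<Union>n. fst (f n))" using P(2) by blast
    show "(\<Union>n. fst (f n)) <#> (\<Union>n. fst (f n)) \<subseteq> U"
    proof
      fix z assume "z \<in> (\<Union>n. fst (f n)) <#> (\<Union>n. fst (f n))"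
      then obtain x y m n where "x \<in> fst (f m)" "y \<in> fst (f n)" "z = x \<otimes> y"
        unfolding set_mult_def by blast
      then have "x \<in> snd (f (max m n))" "y \<in> snd (f (max m n))"
        using mono[of m "max m n"] mono[of n "max m n"] P(3)[of "max m n"] by auto
      with \<open>z = x \<otimes> y\<close> P(4)[of "max m n"] show "z \<in> U" unfolding set_mult_def by blast
    qed
  qed
qed

text \<open>With translations continuous, continuity of multiplication at \<open>(a, b)\<close>
  reduces to the identity, where \<open>final_square_neighbourhood\<close> supplies it.\<close>

lemma topological_group_final: "topological_group G final_topology"
  unfolding topological_group_def
proof (intro conjI)
  show "group G" by (rule is_group)
  show "topspace final_topology = carrier G" by (rule topspace_final_topology)
  show "continuous_map final_topology final_topology (m_inv G)" by (rule continuous_map_final_inv)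
  let ?F = final_topology
  have pre: "openin ?F {x \<in> carrier G. f x \<in> U}" if "continuous_map ?F ?F f" "openin ?F U" for f U
    using openin_continuous_map_preimage[OF that] by (simp add: topspace_final_topology)
  have "openin (prod_topology ?F ?F) {p \<in> carrier G \<times> carrier G. fst p \<otimes> snd p \<in> U}"
    if U: "openin ?F U" for U
    unfolding openin_prod_topology_alt
  proof (intro allI impI)
    fix a b assume "(a, b) \<in> {p \<in> carrier G \<times> carrier G. fst p \<otimes> snd p \<in> U}"
    then have ab: "a \<in> carrier G" "b \<in> carrier G" "a \<otimes> b \<in> U" by auto
    \<comment> \<open>\<open>x y = (a b) ((a b)\<inverse> x b) (b\<inverse> y)\<close>\<close>
    have "openin ?F {x \<in> carrier G. (a \<otimes> b) \<otimes> x \<in> U}"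
      using ab U by (intro pre continuous_map_final_translate) auto
    then obtain V where V: "openin ?F V" "\<one> \<in> V" "V <#> V \<subseteq> {x \<in> carrier G. (a \<otimes> b) \<otimes> x \<in> U}"
      using final_square_neighbourhood[of "{x \<in> carrier G. (a \<otimes> b) \<otimes> x \<in> U}"] ab by auto
    let ?A = "{x \<in> carrier G. inv (a \<otimes> b) \<otimes> x \<otimes> b \<in> V}"
    let ?B = "{y \<in> carrier G. inv b \<otimes> y \<in> V}"
    have "continuous_map ?F ?F ((\<lambda>x. x \<otimes> b) \<circ> (\<lambda>x. inv (a \<otimes> b) \<otimes> x))"
      using ab by (intro continuous_map_compose[of _ ?F] continuous_map_final_translate) auto
    then have "openin ?F ?A"
      using pre[OF _ V(1)] by (simp add: comp_def)
    moreover have "openin ?F ?B"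
      using ab V(1) by (intro pre continuous_map_final_translate) auto
    moreover have "a \<in> ?A" "b \<in> ?B"
      using ab V(2) by (auto simp: m_assoc)
    moreover have "?A \<times> ?B \<subseteq> {p \<in> carrier G \<times> carrier G. fst p \<otimes> snd p \<in> U}"
    proof clarsimp
      fix x y assume x: "x \<in> carrier G" "inv (a \<otimes> b) \<otimes> x \<otimes> b \<in> V"
        and y: "y \<in> carrier G" "inv b \<otimes> y \<in> V"
      have "(inv (a \<otimes> b) \<otimes> x \<otimes> b) \<otimes> (inv b \<otimes> y) \<in> V <#> V"
        using x y unfolding set_mult_def by blast
      then have "(a \<otimes> b) \<otimes> ((inv (a \<otimes> b) \<otimes> x \<otimes> b) \<otimes> (inv b \<otimes> y)) \<in> U"
        using V(3) by blast
      moreover have "(inv (a \<otimes> b) \<otimes> x \<otimes> b) \<otimes> (inv b \<otimes> y) = inv (a \<otimes> b) \<otimes> (x \<otimes> y)"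
        using ab x(1) y(1) by (metis inv_closed inv_solve_left m_assoc m_closed)
      moreover have "(a \<otimes> b) \<otimes> (inv (a \<otimes> b) \<otimes> (x \<otimes> y)) = x \<otimes> y"
        using ab x(1) y(1) by (metis inv_closed inv_solve_left m_closed)
      ultimately show "x \<otimes> y \<in> U" by simp
    qed
    ultimately show "\<exists>A B. openin ?F A \<and> openin ?F B \<and> a \<in> A \<and> b \<in> B \<and>
        A \<times> B \<subseteq> {p \<in> carrier G \<times> carrier G. fst p \<otimes> snd p \<in> U}"
      by blast
  qed
  then show "continuous_map (prod_topology ?F ?F) ?F (\<lambda>(x, y). x \<otimes> y)"
    by (auto simp: continuous_map_def topspace_final_topology split_beta Pi_iff)
qed

section \<open>Completeness\<close>

text \<open>What is exhausted is not \<open>G\<close> but an open identity neighbourhood closed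
  under products. Each stage encloses the compact square of the previous one; the interlaced open
  sets \<open>O' n\<close> make the union open.\<close>

lemma compact_exhaustion:
  obtains L O' where "\<And>n. compactin final_topology (L n)" "\<And>n. openin (Ts n) (O' n)"
    "\<And>n. O' n \<subseteq> L n" "\<And>n. \<one> \<in> O' n" "\<And>n. L n \<subseteq> O' (Suc n)" "\<And>n. L n <#> L n \<subseteq> L (Suc n)"
proof -
  let ?P = "\<lambda>n p. openin (Ts n) (fst p) \<and> compactin (Ts n) (snd p) \<and> \<one> \<in> fst p \<and> fst p \<subseteq> snd p"
  let ?Q = "\<lambda>n p q. snd p <#> snd p \<subseteq> fst q"
  have extend: "\<exists>p. ?P n p \<and> C \<subseteq> fst p" if C: "compactin (Ts n) C" "\<one> \<in> C" for n C
  proof -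
    obtain V K where "openin (Ts n) V" "compactin (Ts n) K" "C \<subseteq> V" "V \<subseteq> K"
      by (rule locally_compact_Hausdorff_between[OF locally_compact Hausdorff C(1) openin_topspace
            compactin_subset_topspace[OF C(1)]])
    with C show ?thesis by (intro exI[of _ "(V, K)"]) auto
  qed
  have "\<exists>f. \<forall>n. ?P n (f n) \<and> ?Q n (f n) (f (Suc n))"
  proof (rule dependent_nat_choice)
    have "compactin (Ts 0) {\<one>}" using one_in_step topspace_step by simp
    then show "\<exists>p. ?P 0 p" using extend[of 0 "{\<one>}"] by blast
  next
    fix p n assume p: "?P n p"
    then have K: "compactin (Ts n) (snd p)" "\<one> \<in> snd p" by auto
    have "compactin (Ts n) (snd p <#> snd p)"
      using compactin_set_mult[OF topological_group_step K(1,1)] set_mult_step compactin_step_subset[OF K(1)]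
      by simp
    moreover have "\<one> \<in> snd p <#> snd p" using K(2) by (force simp: set_mult_def)
    ultimately show "\<exists>q. ?P (Suc n) q \<and> ?Q n p q"
      using extend[of "Suc n" "snd p <#> snd p"] compactin_step_mono[of n _ "Suc n"] by auto
  qed
  then obtain f where f: "\<forall>n. ?P n (f n) \<and> ?Q n (f n) (f (Suc n))" ..
  have P: "openin (Ts n) (fst (f n))" "compactin (Ts n) (snd (f n))" "\<one> \<in> fst (f n)"
    "fst (f n) \<subseteq> snd (f n)" for n
    using f by blast+
  \<comment> \<open>The recursion controls only squares; since \<open>\<one>\<close> belongs to each
    compact set, the sets themselves are controlled too.\<close>
  have sub: "snd (f n) \<subseteq> snd (f n) <#> snd (f n)" for n
  proof
    fix x assume x: "x \<in> snd (f n)"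
    then have "x = x \<otimes> \<one>" using compactin_step_subset[OF P(2)] carrier_step_subset by fastforce
    with x P(3,4) show "x \<in> snd (f n) <#> snd (f n)" unfolding set_mult_def by blast
  qed
  show thesis
  proof (rule that[of "\<lambda>n. snd (f n)" "\<lambda>n. fst (f n)"])
    fix n
    show "compactin final_topology (snd (f n))"
      using image_compactin[OF P(2) continuous_map_step_final] by simp
    show "snd (f n) \<subseteq> fst (f (Suc n))" using sub f by blast
    show "snd (f n) <#> snd (f n) \<subseteq> snd (f (Suc n))" using f by blast
  qed (use P in auto)
qed

text \<open>
  If \<open>x\<close> eventually avoids a neighbourhood \<open>L n <#> W n\<close> of each \<open>L n\<close>, then the intersection of
  the sets \<open>L n <#> W (Suc n)\<close> is still an identity neighbourhood, since near each point of
  \<open>\<Union>n. L n\<close> all but finitely many of them are redundant. Applying the Cauchy condition to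
  it puts \<open>x\<close> eventually into some \<open>L m <#> L m <#> W (Suc m)\<close>, which is excluded.
\<close>
lemma Cauchy_net_in_exhaustion_near_compact:
  assumes C: "left_Cauchy_net G final_topology A leq x"
    and O': "\<And>n. openin (Ts n) (O' n)" "\<And>n. O' n \<subseteq> L n" "\<And>n. \<one> \<in> O' n"
      "\<And>n. L n \<subseteq> O' (Suc n)" "\<And>n. L n <#> L n \<subseteq> L (Suc n)"
    and c: "c \<in> A" "\<And>a. a \<in> A \<Longrightarrow> leq c a \<Longrightarrow> x a \<in> (\<Union>n. L n)"
  shows "\<exists>n. \<forall>W b. openin final_topology W \<and> \<one> \<in> W \<and> b \<in> A \<longrightarrow> (\<exists>a\<in>A. leq b a \<and> x a \<in> L n <#> W)"
proof (rule ccontr)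
  let ?F = final_topology
  assume "\<not> ?thesis"
  then obtain W b where W: "\<And>n. openin ?F (W n)" "\<And>n. \<one> \<in> W n" and b: "\<And>n. b n \<in> A"
    and avoid: "\<And>n a. a \<in> A \<Longrightarrow> leq (b n) a \<Longrightarrow> x a \<notin> L n <#> W n"
    by atomize_elim (simp, metis)
  have LG: "L n \<subseteq> carrier G" for n
    using O'(1,4) openin_step_subset carrier_step_subset by blast
  have WG: "W n \<subseteq> carrier G" for n
    using W(1) openin_final_topology by blast
  have O'step: "O' n \<subseteq> O' (Suc n)" for n using O'(2)[of n] O'(4)[of n] by blast
  have Lstep: "L n \<subseteq> L (Suc n)" for n using O'(4)[of n] O'(2)[of "Suc n"] by blast
  have mono: "L m \<subseteq> L n" if "m \<le> n" for m n
    using lift_Suc_mono_le[of L, OF Lstep that] .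
  have LW: "L n \<subseteq> L n <#> W m" for m n
  proof
    fix x assume "x \<in> L n"
    moreover from this have "x = x \<otimes> \<one>" using LG by fastforce
    ultimately show "x \<in> L n <#> W m" using W(2) unfolding set_mult_def by blast
  qed
  \<comment> \<open>The shift to \<open>W (Suc n)\<close> anticipates one multiplication: a point of
    \<open>L m\<close> times an element of \<open>L m <#> W (Suc m)\<close> lands in
    \<open>L (Suc m) <#> W (Suc m)\<close>, a set with matching indices and hence eventually
    avoided.\<close>
  define V where "V k = O' k \<inter> (\<Inter>n. L n <#> W (Suc n))" for k
  have "openin (Ts k) (V k)" for k
  proof -
    let ?S = "\<lambda>n. (L n <#> W (Suc n)) \<inter> carrier (Gs k)"
    have redundant: "O' k \<subseteq> L n <#> W (Suc n)" if "k \<le> n" for n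
      using that O'(2)[of k] mono[of k n] LW[of n "Suc n"] by blast
    have OG: "O' k \<subseteq> carrier (Gs k)"
      using openin_step_subset[OF O'(1)] .
    \<comment> \<open>Only the indices \<open>n < k\<close> remain, and the trace on
      \<open>Gs k\<close> of a set open in the final topology is open in
      \<open>Ts k\<close>.\<close>
    have "V k = O' k \<inter> (\<Inter>n\<in>{..<k}. ?S n)"
    proof (intro equalityI subsetI)
      fix x assume "x \<in> V k"
      then show "x \<in> O' k \<inter> (\<Inter>n\<in>{..<k}. ?S n)"
        using OG unfolding V_def by blast
    next
      fix x assume x: "x \<in> O' k \<inter> (\<Inter>n\<in>{..<k}. ?S n)"
      have "x \<in> L n <#> W (Suc n)" for n
      proof (cases "n < k")
        case True
        with x show ?thesis by blast
      next
        case False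
        with x redundant[of n] show ?thesis by auto
      qed
      with x show "x \<in> V k" unfolding V_def by blast
    qed
    moreover have "openin (Ts k) (?S n)" for n
      using openin_set_mult[OF topological_group_final W(1) LG] by (simp add: openin_final_topology)
    then have "openin (Ts k) (O' k \<inter> (\<Inter>n\<in>{..<k}. ?S n))"
      using O'(1)[of k] by (intro openin_Int_Inter) blast+
    ultimately show ?thesis by (simp only:)
  qed
  moreover have "V k \<subseteq> V (Suc k)" for k using O'step by (auto simp: V_def)
  ultimately have "openin ?F (\<Union>k. V k)"
    by (rule openin_final_topology_increasing_UN)
  moreover have "\<one> \<in> (\<Union>k. V k)"
  proof -
    have "\<one> \<in> L n <#> W (Suc n)" for n
      using O'(2)[of n] O'(3)[of n] LW[of n "Suc n"] by blast
    then show ?thesis using O'(3) by (auto simp: V_def)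
  qed
  ultimately obtain d where d: "d \<in> A"
    "\<And>a b. a \<in> A \<Longrightarrow> b \<in> A \<Longrightarrow> leq d a \<Longrightarrow> leq d b \<Longrightarrow> inv (x b) \<otimes> x a \<in> (\<Union>k. V k)"
    by (rule left_Cauchy_net_openD[OF C topological_group_final]) blast
  \<comment> \<open>The base index \<open>e\<close> is fixed first: it determines \<open>m\<close>,
    and only then is \<open>a\<close> taken beyond \<open>b (Suc m)\<close>.\<close>
  obtain e where e: "e \<in> A" "leq c e" "leq d e"
    using left_Cauchy_netD(2)[OF C c(1) d(1)] left_Cauchy_netD(3)[OF C] by blast
  obtain m where m: "x e \<in> L m" using c(2)[OF e(1,2)] by blast
  obtain a where a: "a \<in> A" "leq d a" "leq (b (Suc m)) a"
    using left_Cauchy_netD(2)[OF C d(1) b] left_Cauchy_netD(3)[OF C] by blast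
  \<comment> \<open>The quotient lies in some unknown \<open>V k\<close>, but every
    \<open>V k\<close> is contained in all the sets \<open>L n <#> W (Suc n)\<close>, so
    \<open>n = m\<close> may be chosen.\<close>
  have "inv (x e) \<otimes> x a \<in> L m <#> W (Suc m)"
    using d(2)[OF a(1) e(1) a(2) e(3)] by (auto simp: V_def)
  then obtain l w where lw: "l \<in> L m" "w \<in> W (Suc m)" "inv (x e) \<otimes> x a = l \<otimes> w"
    unfolding set_mult_def by blast
  have car: "x e \<in> carrier G" "x a \<in> carrier G" "l \<in> carrier G" "w \<in> carrier G"
    using left_Cauchy_netD(4)[OF C] e(1) a(1) subsetD[OF LG lw(1)] subsetD[OF WG lw(2)] by auto
  then have "x a = (x e \<otimes> l) \<otimes> w"
    using lw(3) by (metis inv_solve_left m_assoc m_closed)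
  moreover have "x e \<otimes> l \<in> L (Suc m)"
    using O'(5) m lw(1) unfolding set_mult_def by blast
  ultimately have "x a \<in> L (Suc m) <#> W (Suc m)"
    using lw(2) unfolding set_mult_def by blast
  with avoid a show False by blast
qed

text \<open>Left translation by \<open>inv (x c)\<close> moves a tail of the net into the union of
  the \<open>L n\<close>; the limit found there is translated back by \<open>x c\<close>.\<close>

lemma left_Cauchy_net_final_converges:
  assumes C: "left_Cauchy_net G final_topology A leq x"
  shows "\<exists>l\<in>carrier G. net_converges final_topology A leq x l"
proof -
  let ?F = final_topology
  obtain L O' where L: "\<And>n. compactin ?F (L n)"
    and O': "\<And>n. openin (Ts n) (O' n)" "\<And>n. O' n \<subseteq> L n" "\<And>n. \<one> \<in> O' n"
      "\<And>n. L n \<subseteq> O' (Suc n)" "\<And>n. L n <#> L n \<subseteq> L (Suc n)"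
    by (rule compact_exhaustion) blast
  have O'step: "O' n \<subseteq> O' (Suc n)" for n using O'(2)[of n] O'(4)[of n] by blast
  have "openin ?F (\<Union>n. O' n)"
    by (rule openin_final_topology_increasing_UN[OF O'(1) O'step])
  moreover have "\<one> \<in> (\<Union>n. O' n)" using O'(3) by blast
  ultimately obtain c where c: "c \<in> A"
    "\<And>a b. a \<in> A \<Longrightarrow> b \<in> A \<Longrightarrow> leq c a \<Longrightarrow> leq c b \<Longrightarrow> inv (x b) \<otimes> x a \<in> (\<Union>n. O' n)"
    by (rule left_Cauchy_net_openD[OF C topological_group_final]) blast
  note car = left_Cauchy_netD(4)[OF C]
  define y where "y a = inv (x c) \<otimes> x a" for a
  have cancel: "x c \<otimes> (inv (x c) \<otimes> z) = z" if "z \<in> carrier G" for z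
    using that car[OF c(1)] by (simp add: m_assoc[symmetric])
  \<comment> \<open>Left translation cancels in these quotients, so \<open>y\<close> inherits the
    Cauchy condition.\<close>
  have quotient: "inv (y b) \<otimes> y a = inv (x b) \<otimes> x a" if "a \<in> A" "b \<in> A" for a b
    using car[OF that(1)] car[OF that(2)] car[OF c(1)] unfolding y_def
    by (simp add: inv_mult_group m_assoc cancel)
  have Cy: "left_Cauchy_net G ?F A leq y"
    unfolding left_Cauchy_net_def
  proof (intro conjI allI impI)
    show "directed_set A leq" using C by (simp add: left_Cauchy_net_def)
    show "y \<in> A \<rightarrow> carrier G" using car c(1) by (auto simp: y_def)
    fix U assume "U \<subseteq> carrier G" "\<one> \<in> ?F interior_of U"
    then obtain d where "d \<in> A" "\<forall>a\<in>A. \<forall>b\<in>A. leq d a \<and> leq d b \<longrightarrow> inv (x b) \<otimes> x a \<in> U"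
      using C unfolding left_Cauchy_net_def by blast
    with quotient show "\<exists>d\<in>A. \<forall>a\<in>A. \<forall>b\<in>A. leq d a \<and> leq d b \<longrightarrow> inv (y b) \<otimes> y a \<in> U"
      by (intro bexI[of _ d]) auto
  qed
  \<comment> \<open>This is the Cauchy condition with one of the two indices equal to
    \<open>c\<close>.\<close>
  have yL: "y a \<in> (\<Union>n. L n)" if "a \<in> A" "leq c a" for a
    using c(2)[OF that(1) c(1) that(2)] left_Cauchy_netD(3)[OF C c(1)] O'(2) unfolding y_def by blast
  obtain n where
    n: "\<forall>W b. openin ?F W \<and> \<one> \<in> W \<and> b \<in> A \<longrightarrow> (\<exists>a\<in>A. leq b a \<and> y a \<in> L n <#> W)"
    using Cauchy_net_in_exhaustion_near_compact[OF Cy O' c(1) yL] by blast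
  have near: "\<exists>a\<in>A. leq b a \<and> y a \<in> L n <#> W" if "openin ?F W" "\<one> \<in> W" "b \<in> A" for W b
    using n that by blast
  obtain l where l: "l \<in> carrier G" "net_converges ?F A leq y l"
    using left_Cauchy_net_near_compact_converges[OF Cy topological_group_final L near] by blast
  have lim: "limitin ?F (\<lambda>a. x c \<otimes> y a) (x c \<otimes> l) (INF \<gamma>\<in>A. principal {\<alpha>\<in>A. leq \<gamma> \<alpha>})"
    using continuous_map_limit[OF continuous_map_final_translate(1)[OF car[OF c(1)]]
        l(2)[unfolded net_converges_def]]
    by (simp add: comp_def)
  have "net_converges ?F A leq (\<lambda>a. x c \<otimes> y a) (x c \<otimes> l)"
    using lim by (simp add: net_converges_def)
  moreover have "x c \<otimes> y a = x a" if "a \<in> A" for a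
    using cancel[OF car[OF that]] unfolding y_def .
  moreover have "directed_set A leq" using C by (simp add: left_Cauchy_net_def)
  \<comment> \<open>The two nets are only known to agree on \<open>A\<close>, which suffices because
    convergence tests only indices in \<open>A\<close>.\<close>
  ultimately have "net_converges ?F A leq x (x c \<otimes> l)"
    by (simp add: net_converges_iff)
  then show ?thesis using car c(1) l(1) by blast
qed

lemma complete_final_topology: "complete_topological_group TYPE('i) G final_topology"
  unfolding complete_topological_group_def
  using topological_group_final left_Cauchy_net_final_converges by blast

end

text \<open>The final topology is finer than \<open>T\<close> because all inclusions are continuous
  into \<open>T\<close>. Conversely, it is itself a group topology with continuous inclusions, so
  \<open>T\<close> is finer than it. Completeness is thus that of the final topology.\<close>

lemma direct_limit_of_locally_compact_complete:
  assumes "strict_direct_sequence Gs Ts" "direct_limit_topological_group Gs Ts G T"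
    and "\<And>n. locally_compact_space (Ts n)" "\<And>n. Hausdorff_space (Ts n)"
  shows "complete_topological_group TYPE('i) G T"
proof -
  have lim: "group G" "carrier G = (\<Union>n. carrier (Gs n))" "\<And>n. (\<lambda>x. x) \<in> hom (Gs n) G"
    "topological_group G T" "\<And>n. continuous_map (Ts n) T (\<lambda>x. x)"
    and finest: "\<forall>T'. topological_group G T' \<and> (\<forall>n. continuous_map (Ts n) T' (\<lambda>x. x)) \<longrightarrow>
      (\<forall>U. openin T' U \<longrightarrow> openin T U)"
    using assms(2) by (simp_all add: direct_limit_topological_group_def)
  interpret locally_compact_direct_sequence G Gs Ts
    using assms lim by (simp add: locally_compact_direct_sequence_def locally_compact_direct_sequence_axioms_def)
  have "continuous_map final_topology T (\<lambda>x. x)"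
    using lim by (simp add: continuous_map_from_final_topology)
  then have "openin final_topology U" if "openin T U" for U
    using topology_finer_continuous_id[of T final_topology] topological_groupD(2)[OF lim(4)] topspace_final_topology that
    by (simp add: id_def)
  moreover have "openin T U" if "openin final_topology U" for U
    using finest topological_group_final continuous_map_step_final that by blast
  ultimately have "T = final_topology"
    by (auto simp: topology_eq)
  then show ?thesis using complete_final_topology by simp
qed

text \<open>Chart domains are homeomorphic to open subsets of Euclidean spaces, and compact
  neighbourhoods within an open chart domain remain such in \<open>T\<close>.\<close>

lemma smooth_atlas_locally_compact:
  assumes "smooth_atlas T d \<A>"
  shows "locally_compact_space T"
  unfolding locally_compact_space_def
proof
  fix x assume "x \<in> topspace T"
  then obtain U \<phi> where chart: "(U, \<phi>) \<in> \<A>" "x \<in> U"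
    using assms unfolding smooth_atlas_def by blast
  then have U: "openin T U" "openin (Euclidean_space d) (\<phi> ` U)"
    "homeomorphic_map (subtopology T U) (subtopology (Euclidean_space d) (\<phi> ` U)) \<phi>"
    using assms unfolding smooth_atlas_def by blast+
  have "locally_compact_space (subtopology (Euclidean_space d) (\<phi> ` U))"
    using U(2) by (simp add: locally_compact_space_open_subset Hausdorff_Euclidean_space
        locally_compact_Euclidean_space)
  then have "locally_compact_space (subtopology T U)"
    using U(3) homeomorphic_locally_compact_space homeomorphic_map_imp_homeomorphic_space by blast
  moreover have "x \<in> topspace (subtopology T U)"
    using chart \<open>x \<in> topspace T\<close> by simp
  ultimately obtain V K where "openin (subtopology T U) V" "compactin (subtopology T U) K" "x \<in> V" "V \<subseteq> K"
    unfolding locally_compact_space_def by blast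
  then show "\<exists>V K. openin T V \<and> compactin T K \<and> x \<in> V \<and> V \<subseteq> K"
    using U(1) by (meson compactin_subtopology openin_trans_full)
qed

text \<open>The Lie group case reduces to the locally compact one: the Hausdorff property is part of
  \<open>Lie_group\<close>, and local compactness comes from the atlas.\<close>

theorem mainTheorem4:
  fixes Gs :: "nat \<Rightarrow> 'a monoid" and Ts :: "nat \<Rightarrow> 'a topology"
    and G :: "'a monoid" and T :: "'a topology"
  assumes "strict_direct_sequence Gs Ts"
    and "direct_limit_topological_group Gs Ts G T"
  shows "((\<forall>n. locally_compact_space (Ts n) \<and> Hausdorff_space (Ts n)) \<longrightarrow>
           complete_topological_group TYPE('i) G T) \<and>
         ((\<exists>d \<A>. \<forall>n. Lie_group (Gs n) (Ts n) (d n) (\<A> n)) \<longrightarrow>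
           complete_topological_group TYPE('i) G T)"
  using direct_limit_of_locally_compact_complete[OF assms] smooth_atlas_locally_compact
  unfolding Lie_group_def by blast

end
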